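(* Let $d\in\mathbb N$, $\boldsymbol\theta\in\mathbb S^{d-1}$, $t\in\mathbb R$, and $\boldsymbol a\in\mathbb R^d_{>0}$. Furthermore, let $\ell := \|\boldsymbol\theta\|_0$ be the number of non-zero entries of $\boldsymbol\theta$. Then the Radon transform of the indicator function of the hypercube $(-\boldsymbol a,\boldsymbol a]$, denoted $A_{\boldsymbol\theta}^{\boldsymbol a}(t) := \mathcal R_{\boldsymbol\theta}[\mathbf 1_{\boldsymbol a}](t)$, satisfies $$ A_{\boldsymbol\theta}^{\boldsymbol a}(t) = \frac{2^{d-\ell}\, P(\boldsymbol a)}{P\big((\boldsymbol a\odot\boldsymbol\theta)^\circ\big)\,(\ell-1)!} \sum_{\boldsymbol k\in\{-1,1\}^\ell} P(\boldsymbol k)\, \big(t+\langle \boldsymbol k,(\boldsymbol a\odot\boldsymbol\theta)^\circ\rangle\big)_+^{\ell-1}. $$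
   Context: $\mathbb S^{d-1}=\{\boldsymbol x\in\mathbb R^d:\|\boldsymbol x\|=1\}$ is the Euclidean unit sphere. For an absolutely integrable function $f\in L^1(\mathbb R^d)$ and $\boldsymbol\theta\in\mathbb S^{d-1}$, the Radon transform is $\mathcal R_{\boldsymbol\theta}[f](t)=\int_{H_{\boldsymbol\theta}(t)} f\,\mathrm d\sigma$, $t\in\mathbb R$, where $H_{\boldsymbol\theta}(t)=\{\boldsymbol x\in\mathbb R^d:\langle\boldsymbol x,\boldsymbol\theta\rangle=t\}$ and $\sigma$ is the surface measure on this hyperplane; for general $f\in L^1(\mathbb R^d)$ it is well-defined for almost all $t\in\mathbb R$. For $\boldsymbol a\in\mathbb R^d_{>0}$ (all entries positive), $(-\boldsymbol a,\boldsymbol a]=(-a_1,a_1]\times\cdots\times(-a_d,a_d]$, and $\mathbf 1_{\boldsymbol a}$ is its indicator function; so $A_{\boldsymbol\theta}^{\boldsymbol a}(t)$ is the surface area of $(-\boldsymbol a,\boldsymbol a]\cap H_{\boldsymbol\theta}(t)$. Notation: $\boldsymbol x\odot\boldsymbol y$ is the componentwise product. $P(\boldsymbol x)=\prod_j x_j$ is the product of all entries of a vector. $\boldsymbol x^\circ\in\mathbb R^{\|\boldsymbol x\|_0}$ is the vector whose $j$-th entry is the $j$-th non-zero entry of $\boldsymbol x$, where $\|\boldsymbol x\|_0$ is the number of non-zero entries of $\boldsymbol x$. $(x)_+=x$ if $x>0$ and $(x)_+=0$ if $x\le 0$; $(x)_+^m$ is its $m$-th power for $m\in\mathbb N_0$,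 with the convention $0^0:=0$ (so $(x)_+^0=1$ for $x>0$ and $(x)_+^0=0$ for $x\le0$).
   Formalization: The case where θ is the negative of the i-th standard unit vector and |t| = a_i is excluded: there the hyperplane contains a facet, half-openness is reversed, and the printed formula is false (at t = a_i the left side is 0, the right side positive; at t = -a_i vice versa). *)

theory Defs
  imports "HOL-Analysis.Analysis"
begin

definition hyperplane :: "'a::euclidean_space \<Rightarrow> real \<Rightarrow> 'a set" where
  "hyperplane \<theta> t = {x. x \<bullet> \<theta> = t}"

definition is_orthonormal_basis_of :: "'a::euclidean_space set \<Rightarrow> 'a set \<Rightarrow> bool" where
  "is_orthonormal_basis_of B S \<longleftrightarrow>
     B \<subseteq> S \<and> pairwise orthogonal B \<and> (\<forall>b\<in>B. norm b = 1) \<and> span B = S"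

lemma hyperplane_orthonormal_basis_exists: "\<exists>B. is_orthonormal_basis_of B (hyperplane \<theta> 0)"
proof -
  have "subspace (hyperplane \<theta> 0)"
    using subspace_hyperplane[of \<theta>] by (simp add: hyperplane_def inner_commute)
  then show ?thesis
    unfolding is_orthonormal_basis_of_def by (metis orthonormal_basis_subspace)
qed

(* For a unit vector \<theta>, the map u \<mapsto> t \<theta> + (\<Sum>b\<in>B. u b * b) is an isometry from R^(d-1)
   onto the hyperplane, so the push-forward of Lebesgue measure under it is the surface measure,
   whichever orthonormal basis B is chosen.  It is a measure on the whole space concentrated on
   the hyperplane; for d = 1 it is the unit point mass at t \<theta>. *)
definition surface_measure :: "'a::euclidean_space \<Rightarrow> real \<Rightarrow> 'a measure" where
  "surface_measure \<theta> t =
     (let B = SOME B. is_orthonormal_basis_of B (hyperplane \<theta> 0)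
      in completion (distr (PiM B (\<lambda>_. lborel)) borel
           (\<lambda>u. t *\<^sub>R \<theta> + (\<Sum>b\<in>B. u b *\<^sub>R b))))"

definition radon :: "'a::euclidean_space \<Rightarrow> ('a \<Rightarrow> real) \<Rightarrow> real \<Rightarrow> real" where
  "radon \<theta> f t = (LINT x:hyperplane \<theta> t|surface_measure \<theta> t. f x)"

(* Half-openness matters only for hyperplanes parallel to a facet: for \<theta> = axis i 1 the slice at
   t = a $ i is a facet and the slice at t = - a $ i is empty, for \<theta> = - axis i 1 it is the
   other way round. *)
definition half_open_cube :: "real ^ 'd \<Rightarrow> (real ^ 'd) set" where
  "half_open_cube a = {x. \<forall>i. - a $ i < x $ i \<and> x $ i \<le> a $ i}"

definition num_nonzero :: "real ^ 'd \<Rightarrow> nat" where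
  "num_nonzero x = card {i. x $ i \<noteq> 0}"

(* The vector of non-zero entries, in increasing order of the coordinate index.  Its dimension
   depends on x, so it is a list; vectors of that dimension and their inner product are lists too. *)
definition nonzero_entries :: "real ^ 'd::{finite,linorder} \<Rightarrow> real list" where
  "nonzero_entries x = map (($) x) (sorted_list_of_set {i. x $ i \<noteq> 0})"

definition sign_vectors :: "nat \<Rightarrow> real list set" where
  "sign_vectors n = {k. length k = n \<and> set k \<subseteq> {-1, 1}}"

definition list_inner :: "real list \<Rightarrow> real list \<Rightarrow> real" where
  "list_inner xs ys = (\<Sum>(x, y)\<leftarrow>zip xs ys. x * y)"

(* 0 at x \<le> 0 also for m = 0. *)
definition trunc_power :: "real \<Rightarrow> nat \<Rightarrow> real" where
  "trunc_power x m = (if x > 0 then x ^ m else 0)"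

end

theory Submission
  imports Defs
begin

text \<open>Choose an index \<open>i\<close> with \<open>\<theta>\<^sub>i \<noteq> 0\<close>. Forgetting the \<open>i\<close>-th coordinate maps the
  hyperplane onto the space of the remaining coordinates and scales its surface measure by \<open>\<bar>\<theta>\<^sub>i\<bar>\<close>, so the slice area is
  an iterated integral over those coordinates of the step function
  \<open>t \<mapsto> 1\<close> if \<open>t / \<theta>\<^sub>i \<in> (- a\<^sub>i, a\<^sub>i]\<close>. A coordinate with \<open>\<theta>\<^sub>j = 0\<close> contributes the factor
  \<open>2 a\<^sub>j\<close>. One with \<open>\<theta>\<^sub>j \<noteq> 0\<close> integrates each truncated power to a central difference of the next
  one with step \<open>a\<^sub>j \<theta>\<^sub>j\<close>, which appends a sign to the vectors \<open>k\<close>.\<close>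

section \<open>Lebesgue measure in orthonormal coordinates\<close>

interpretation lborel_prod: product_sigma_finite "\<lambda>_::'i. lborel :: real measure"
  by unfold_locales

text \<open>A finite product measure is determined by its values on boxes, and translating a box
  changes none of its side lengths.\<close>

lemma PiM_lborel_translate:
  fixes c :: "'i \<Rightarrow> real"
  assumes "finite I"
  shows "distr (Pi\<^sub>M I (\<lambda>_. lborel)) (Pi\<^sub>M I (\<lambda>_. lborel)) (\<lambda>u. \<lambda>i\<in>I. u i + c i) = Pi\<^sub>M I (\<lambda>_. lborel)"
proof (rule lborel_prod.PiM_eqI[OF assms])
  fix A :: "'i \<Rightarrow> real set"
  assume A: "\<And>i. i \<in> I \<Longrightarrow> A i \<in> sets lborel"
  have shift: "emeasure lborel ((\<lambda>x. x + c i) -` A i) = emeasure lborel (A i)" if "i \<in> I" for i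
  proof -
    have plus: "(+) (c i) = (\<lambda>x. x + c i)" by (auto simp: add.commute)
    have "emeasure lborel (A i) = emeasure (distr lborel borel ((+) (c i))) (A i)"
      by (simp add: lborel_distr_plus)
    also have "\<dots> = emeasure lborel ((\<lambda>x. x + c i) -` A i)"
      using A[OF that] by (subst emeasure_distr) (auto simp: plus)
    finally show ?thesis by simp
  qed
  have sets: "(\<lambda>x. x + c i) -` A i \<in> sets lborel" if "i \<in> I" for i
    using measurable_sets[of "\<lambda>x. x + c i" borel borel "A i"] A[OF that] by simp
  have "(\<lambda>u. \<lambda>i\<in>I. u i + c i) -` Pi\<^sub>E I A \<inter> space (Pi\<^sub>M I (\<lambda>_. lborel))
      = Pi\<^sub>E I (\<lambda>i. (\<lambda>x. x + c i) -` A i)"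
    by (auto simp: space_PiM PiE_iff)
  moreover have "Pi\<^sub>E I A \<in> sets (Pi\<^sub>M I (\<lambda>_. lborel))"
    using A by (intro sets_PiM_I_finite assms) auto
  ultimately show "emeasure (distr (Pi\<^sub>M I (\<lambda>_. lborel)) (Pi\<^sub>M I (\<lambda>_. lborel)) (\<lambda>u. \<lambda>i\<in>I. u i + c i)) (Pi\<^sub>E I A)
      = (\<Prod>i\<in>I. emeasure lborel (A i))"
    using sets shift
    by (subst emeasure_distr) (auto simp: lborel_prod.emeasure_PiM[OF assms] intro!: prod.cong)
qed simp

text \<open>A shift by a combination of the \<open>e i\<close> is a shift of the coordinates. The
  family \<open>e\<close> is arbitrary: it will be an orthonormal basis of the whole space, where
  every \<open>w\<close> qualifies, and one of a hyperplane, where \<open>w\<close> must be parallel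
  to it.\<close>

lemma nn_integral_PiM_translate:
  fixes e :: "'i \<Rightarrow> 'a::euclidean_space" and h :: "'a \<Rightarrow> ennreal"
  assumes "finite I" and h[measurable]: "h \<in> borel_measurable borel" and w: "w = (\<Sum>i\<in>I. c i *\<^sub>R e i)"
  shows "(\<integral>\<^sup>+u. h ((\<Sum>i\<in>I. u i *\<^sub>R e i) + w) \<partial>Pi\<^sub>M I (\<lambda>_. lborel))
       = (\<integral>\<^sup>+u. h (\<Sum>i\<in>I. u i *\<^sub>R e i) \<partial>Pi\<^sub>M I (\<lambda>_. lborel))" (is "_ = ?R")
proof -
  have "?R = (\<integral>\<^sup>+u. h (\<Sum>i\<in>I. u i *\<^sub>R e i)
      \<partial>distr (Pi\<^sub>M I (\<lambda>_. lborel)) (Pi\<^sub>M I (\<lambda>_. lborel)) (\<lambda>u. \<lambda>i\<in>I. u i + c i))"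
    by (simp only: PiM_lborel_translate[OF assms(1)])
  also have "\<dots> = (\<integral>\<^sup>+u. h ((\<Sum>i\<in>I. u i *\<^sub>R e i) + w) \<partial>Pi\<^sub>M I (\<lambda>_. lborel))"
    by (subst nn_integral_distr)
       (auto simp: w sum.distrib[symmetric] scaleR_add_left intro!: nn_integral_cong arg_cong[of _ _ h] sum.cong)
  finally show ?thesis by simp
qed

text \<open>A translation-invariant measure is a multiple of Lebesgue measure by Fubini's theorem;
  comparing the unit balls shows that the factor is 1.\<close>

lemma nn_integral_lborel_orthonormal:
  fixes e :: "'i \<Rightarrow> 'a::euclidean_space"
  assumes I[simp]: "finite I" "card I = DIM('a)"
    and orth: "\<And>i j. i \<in> I \<Longrightarrow> j \<in> I \<Longrightarrow> e i \<bullet> e j = (if i = j then 1 else 0)"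
    and expand: "\<And>x. x = (\<Sum>i\<in>I. (x \<bullet> e i) *\<^sub>R e i)"
    and h[measurable]: "h \<in> borel_measurable borel"
  shows "(\<integral>\<^sup>+x. h x \<partial>lborel) = (\<integral>\<^sup>+u. h (\<Sum>i\<in>I. u i *\<^sub>R e i) \<partial>Pi\<^sub>M I (\<lambda>_. lborel))"
proof -
  define P where "P = Pi\<^sub>M I (\<lambda>_. lborel :: real measure)"
  define \<phi> where "\<phi> u = (\<Sum>i\<in>I. u i *\<^sub>R e i)" for u :: "'i \<Rightarrow> real"
  have \<phi>[measurable]: "\<phi> \<in> borel_measurable P"
    unfolding \<phi>_def P_def by measurable
  \<comment> \<open>The ball serves as test set because in orthonormal coordinates it becomes the
    Euclidean ball of \<open>I\<close>-tuples, so its measure is the same known constant on both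
    sides.\<close>
  define E where "E = (cball 0 1 :: 'a set)"
  have E[measurable]: "E \<in> sets borel" by (simp add: E_def)
  have shift: "(\<integral>\<^sup>+u. g (\<phi> u + w) \<partial>P) = (\<integral>\<^sup>+u. g (\<phi> u) \<partial>P)"
    if "g \<in> borel_measurable borel" for g :: "'a \<Rightarrow> ennreal" and w
    unfolding \<phi>_def P_def by (rule nn_integral_PiM_translate[OF I(1) that expand])
  have lshift: "(\<integral>\<^sup>+x. g (x + w) \<partial>lborel) = (\<integral>\<^sup>+x. g x \<partial>lborel)"
    if [measurable]: "g \<in> borel_measurable borel" for g :: "'a \<Rightarrow> ennreal" and w
    by (subst (2) lborel_distr_plus[of w, symmetric])
       (subst nn_integral_distr, auto simp: add.commute)
  interpret sigma_finite_measure P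
    unfolding P_def by (rule lborel_prod.sigma_finite) simp
  interpret pair_sigma_finite lborel P ..
  define \<beta> where "\<beta> = ennreal (unit_ball_vol (real DIM('a)))"
  have norm_\<phi>: "norm (\<phi> u) = sqrt (\<Sum>i\<in>I. (u i)\<^sup>2)" for u
  proof -
    have "\<phi> u \<bullet> \<phi> u = (\<Sum>i\<in>I. \<Sum>j\<in>I. u i * (u j * (e j \<bullet> e i)))"
      by (simp add: \<phi>_def inner_sum_left inner_sum_right sum_distrib_left)
    also have "\<dots> = (\<Sum>i\<in>I. \<Sum>j\<in>I. if j = i then (u i)\<^sup>2 else 0)"
      by (intro sum.cong refl) (auto simp: orth power2_eq_square)
    also have "\<dots> = (\<Sum>i\<in>I. (u i)\<^sup>2)" by simp
    finally show ?thesis by (simp add: norm_eq_sqrt_inner)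
  qed
  have N: "(\<integral>\<^sup>+u. indicator E (\<phi> u) \<partial>P) = \<beta>"
  proof -
    have "(\<integral>\<^sup>+u. indicator E (\<phi> u) \<partial>P) = (\<integral>\<^sup>+u. indicator (\<phi> -` E \<inter> space P) u \<partial>P)"
      by (intro nn_integral_cong) (auto simp: indicator_def)
    also have "\<dots> = emeasure P (\<phi> -` E \<inter> space P)" by simp
    also have "\<phi> -` E \<inter> space P = {f. sqrt (\<Sum>i\<in>I. (f i)\<^sup>2) \<le> 1} \<inter> space P"
      by (auto simp: E_def norm_\<phi>)
    also have "emeasure P \<dots> = \<beta>"
      unfolding P_def \<beta>_def by (subst emeasure_cball_aux) auto
    finally show ?thesis .
  qed
  have \<beta>E: "emeasure lborel E = \<beta>"
    by (simp add: \<beta>_def E_def emeasure_cball)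
  have \<beta>: "\<beta> \<noteq> 0" "\<beta> \<noteq> \<infinity>"
    using less_imp_neq[OF unit_ball_vol_pos[of "real DIM('a)"]] by (auto simp: \<beta>_def)
  \<comment> \<open>Both factors go under one double integral. Swapping the order and substituting
    \<open>x - \<phi> u\<close> for \<open>x\<close> then moves the dependence on \<open>u\<close>
    from \<open>h\<close> to the ball.\<close>
  have "\<beta> * (\<integral>\<^sup>+u. h (\<phi> u) \<partial>P) = (\<integral>\<^sup>+x. indicator E x * (\<integral>\<^sup>+u. h (\<phi> u) \<partial>P) \<partial>lborel)"
    by (subst nn_integral_multc) (simp_all add: \<beta>E)
  also have "\<dots> = (\<integral>\<^sup>+x. \<integral>\<^sup>+u. indicator E x * h (\<phi> u + x) \<partial>P \<partial>lborel)"
    by (simp add: shift nn_integral_cmult)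
  also have "\<dots> = (\<integral>\<^sup>+u. \<integral>\<^sup>+x. indicator E x * h (\<phi> u + x) \<partial>lborel \<partial>P)"
    by (rule Fubini'[symmetric]) measurable
  also have "\<dots> = (\<integral>\<^sup>+u. \<integral>\<^sup>+x. indicator E (x - \<phi> u) * h x \<partial>lborel \<partial>P)"
  proof (rule nn_integral_cong)
    fix u
    show "(\<integral>\<^sup>+x. indicator E x * h (\<phi> u + x) \<partial>lborel) = (\<integral>\<^sup>+x. indicator E (x - \<phi> u) * h x \<partial>lborel)"
      using lshift[of "\<lambda>x. indicator E (x - \<phi> u) * h x" "\<phi> u"] by (simp add: add.commute)
  qed
  also have "\<dots> = (\<integral>\<^sup>+x. \<integral>\<^sup>+u. indicator E (x - \<phi> u) * h x \<partial>P \<partial>lborel)"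
    by (rule Fubini') measurable
  also have "\<dots> = (\<integral>\<^sup>+x. \<beta> * h x \<partial>lborel)"
  proof (rule nn_integral_cong)
    fix x
    have "(\<integral>\<^sup>+u. indicator E (x - \<phi> u) * h x \<partial>P) = (\<integral>\<^sup>+u. indicator E (x - \<phi> u) \<partial>P) * h x"
      by (rule nn_integral_multc) measurable
    \<comment> \<open>The ball is symmetric about 0, so only a translate of it has to be
      measured.\<close>
    also have "(\<integral>\<^sup>+u. indicator E (x - \<phi> u) \<partial>P) = (\<integral>\<^sup>+u. indicator E (\<phi> u + (- x)) \<partial>P)"
      by (intro nn_integral_cong) (auto simp: indicator_def E_def norm_minus_commute)
    also have "\<dots> = \<beta>"
      using shift[of "indicator E" "-x"] N by simp
    finally show "(\<integral>\<^sup>+u. indicator E (x - \<phi> u) * h x \<partial>P) = \<beta> * h x" .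
  qed
  also have "\<dots> = \<beta> * (\<integral>\<^sup>+x. h x \<partial>lborel)"
    by (rule nn_integral_cmult) simp
  finally show ?thesis
    using \<beta> by (simp add: ennreal_mult_cancel_left P_def \<phi>_def)
qed

section \<open>Surface measure of a hyperplane in graph coordinates\<close>

text \<open>Adding the unit normal to an orthonormal basis of its orthogonal complement gives an
  orthonormal basis of the whole space. The facts are collected in the form that the change of
  coordinates for Lebesgue measure takes as premises.\<close>

lemma orthonormal_basis_insert_normal:
  fixes \<theta> :: "'a::euclidean_space"
  assumes B: "is_orthonormal_basis_of B (hyperplane \<theta> 0)" and \<theta>: "norm \<theta> = 1"
  shows "finite B" "\<theta> \<notin> B" "card (insert \<theta> B) = DIM('a)"
    and "\<And>b c. b \<in> insert \<theta> B \<Longrightarrow> c \<in> insert \<theta> B \<Longrightarrow> b \<bullet> c = (if b = c then 1 else 0)"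
    and "\<And>x. x = (\<Sum>b\<in>insert \<theta> B. (x \<bullet> b) *\<^sub>R b)"
    and "\<And>x. x \<bullet> \<theta> = 0 \<Longrightarrow> x = (\<Sum>b\<in>B. (x \<bullet> b) *\<^sub>R b)"
proof -
  have BS: "b \<bullet> \<theta> = 0" if "b \<in> B" for b
    using B that by (auto simp: is_orthonormal_basis_of_def hyperplane_def)
  have po: "pairwise orthogonal B" and n1: "\<And>b. b \<in> B \<Longrightarrow> norm b = 1"
    and sp: "span B = {x. x \<bullet> \<theta> = 0}"
    using B by (auto simp: is_orthonormal_basis_of_def hyperplane_def)
  have "0 \<notin> B" using n1 by force
  then have ind: "independent B" by (rule pairwise_orthogonal_independent[OF po])
  then show fin: "finite B" by (rule independent_imp_finite)
  have \<theta>1: "\<theta> \<bullet> \<theta> = 1" using \<theta> by (simp add: norm_eq_1)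
  then show notin: "\<theta> \<notin> B" using BS by force
  have "card B = dim {x. \<theta> \<bullet> x = 0}"
    using dim_eq_card_independent[OF ind] dim_span[of B] sp by (simp add: inner_commute)
  also have "\<dots> = DIM('a) - 1"
    using \<theta> by (intro dim_hyperplane) auto
  finally show "card (insert \<theta> B) = DIM('a)"
    using fin notin DIM_positive[where 'a='a] by simp
  show "b \<bullet> c = (if b = c then 1 else 0)" if "b \<in> insert \<theta> B" "c \<in> insert \<theta> B" for b c
    using that BS BS[THEN trans[OF inner_commute]] \<theta>1 n1 po
    by (auto simp: norm_eq_1 pairwise_def orthogonal_def)
  show exp0: "x = (\<Sum>b\<in>B. (x \<bullet> b) *\<^sub>R b)" if "x \<bullet> \<theta> = 0" for x
    using orthonormal_basis_expand[OF po n1 _ fin, of x] that sp by auto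
  show "x = (\<Sum>b\<in>insert \<theta> B. (x \<bullet> b) *\<^sub>R b)" for x
  proof -
    have "x - (x \<bullet> \<theta>) *\<^sub>R \<theta> = (\<Sum>b\<in>B. ((x - (x \<bullet> \<theta>) *\<^sub>R \<theta>) \<bullet> b) *\<^sub>R b)"
      by (rule exp0) (simp add: inner_diff_left \<theta>1)
    also have "\<dots> = (\<Sum>b\<in>B. (x \<bullet> b) *\<^sub>R b)"
      using BS[THEN trans[OF inner_commute]] by (intro sum.cong refl) (simp add: inner_diff_left)
    finally show ?thesis using fin notin by (simp add: algebra_simps)
  qed
qed

text \<open>Both sides equal the integral of \<^term>\<open>\<lambda>x. h (x + (t - x \<bullet> \<theta>) *\<^sub>R v)\<close> over the slab
  between the hyperplanes at levels 0 and 1, where \<^term>\<open>v\<close> is the multiple of the \<^term>\<open>i\<close>-th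
  unit vector with \<^term>\<open>v \<bullet> \<theta> = 1\<close>. The integrand projects along \<^term>\<open>v\<close> onto the hyperplane
  at level \<^term>\<open>t\<close>.\<close>

lemma nn_integral_hyperplane_graph:
  fixes \<theta> :: "real ^ 'd"
  assumes B: "is_orthonormal_basis_of B (hyperplane \<theta> 0)" and \<theta>: "norm \<theta> = 1"
    and i: "\<theta> $ i \<noteq> 0" and h[measurable]: "h \<in> borel_measurable borel"
  shows "(\<integral>\<^sup>+u. h (t *\<^sub>R \<theta> + (\<Sum>b\<in>B. u b *\<^sub>R b)) \<partial>Pi\<^sub>M B (\<lambda>_. lborel))
    = ennreal (1 / \<bar>\<theta> $ i\<bar>) * (\<integral>\<^sup>+y. h (\<chi> j. if j = i then (t - (\<Sum>j\<in>-{i}. y j * \<theta> $ j)) / \<theta> $ i else y j)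
        \<partial>Pi\<^sub>M (-{i}) (\<lambda>_. lborel))" (is "?L = ?R")
proof -
  note Bfacts = orthonormal_basis_insert_normal[OF B \<theta>]
  have \<theta>1: "\<theta> \<bullet> \<theta> = 1" using \<theta> by (simp add: norm_eq_1)
  have B\<theta>: "(\<Sum>b\<in>B. u b *\<^sub>R b) \<bullet> \<theta> = 0" for u
    using Bfacts(2,4) by (auto simp: inner_sum_left intro!: sum.neutral)
  have UN: "insert i (-{i}) = UNIV" by auto
  have [measurable]: "(\<lambda>y. \<chi> j. if j = i then (t - (\<Sum>j\<in>-{i}. y j * \<theta> $ j)) / \<theta> $ i else y j)
      \<in> borel_measurable (Pi\<^sub>M (-{i}) (\<lambda>_. borel :: real measure))" (is "?p \<in> _")
  proof (subst borel_measurable_euclidean_space, intro ballI)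
    fix b :: "real ^ 'd" assume "b \<in> Basis"
    then obtain j where b: "b = axis j 1" by (auto simp: Basis_vec_def)
    show "(\<lambda>y. ?p y \<bullet> b) \<in> borel_measurable (Pi\<^sub>M (-{i}) (\<lambda>_. borel))"
      by (cases "j = i") (simp_all add: b inner_axis)
  qed
  define v :: "real ^ 'd" where "v = axis i (1 / \<theta> $ i)"
  have v\<theta>: "v \<bullet> \<theta> = 1" using i by (simp add: v_def inner_axis')
  \<comment> \<open>The slab has thickness 1, so integrating a quantity that is independent of the
    level over all levels returns that quantity.\<close>
  define f where "f x = h (x + (t - x \<bullet> \<theta>) *\<^sub>R v) * indicator {0..1} (x \<bullet> \<theta>)" for x
  have f[measurable]: "f \<in> borel_measurable borel"
    unfolding f_def by measurable
  have "(\<integral>\<^sup>+x. f x \<partial>lborel) = (\<integral>\<^sup>+u. f (\<Sum>b\<in>insert \<theta> B. u b *\<^sub>R b) \<partial>Pi\<^sub>M (insert \<theta> B) (\<lambda>_. lborel))"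
    using Bfacts by (intro nn_integral_lborel_orthonormal) auto
  also have "\<dots> = (\<integral>\<^sup>+s. \<integral>\<^sup>+u. f (\<Sum>b\<in>insert \<theta> B. (u(\<theta> := s)) b *\<^sub>R b) \<partial>Pi\<^sub>M B (\<lambda>_. lborel) \<partial>lborel)"
    using Bfacts by (intro lborel_prod.product_nn_integral_insert_rev) (auto intro!: measurable_compose[OF _ f])
  also have "\<dots> = (\<integral>\<^sup>+(s::real). ?L * indicator {0..1} s \<partial>lborel)"
  proof (rule nn_integral_cong)
    fix s :: real
    \<comment> \<open>This is the discrepancy between moving from level \<open>s\<close> to level
      \<open>t\<close> along \<open>v\<close> and along \<open>\<theta>\<close>. As \<open>v\<close>
      and \<open>\<theta>\<close> have the same inner product with \<open>\<theta>\<close>, it is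
      parallel to the hyperplane and can be translated away.\<close>
    define w where "w = (t - s) *\<^sub>R (v - \<theta>)"
    have sum: "(\<Sum>b\<in>insert \<theta> B. (u(\<theta> := s)) b *\<^sub>R b) = s *\<^sub>R \<theta> + (\<Sum>b\<in>B. u b *\<^sub>R b)" for u
      using Bfacts(1,2) by (simp, intro sum.cong) auto
    have fs: "f (\<Sum>b\<in>insert \<theta> B. (u(\<theta> := s)) b *\<^sub>R b)
        = h (t *\<^sub>R \<theta> + ((\<Sum>b\<in>B. u b *\<^sub>R b) + w)) * indicator {0..1} s" for u
      unfolding sum f_def by (simp add: inner_add_left \<theta>1 B\<theta> w_def algebra_simps)
    have "(\<integral>\<^sup>+u. f (\<Sum>b\<in>insert \<theta> B. (u(\<theta> := s)) b *\<^sub>R b) \<partial>Pi\<^sub>M B (\<lambda>_. lborel))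
      = (\<integral>\<^sup>+u. h (t *\<^sub>R \<theta> + ((\<Sum>b\<in>B. u b *\<^sub>R b) + w)) \<partial>Pi\<^sub>M B (\<lambda>_. lborel)) * indicator {0..1} s"
      unfolding fs by (rule nn_integral_multc) measurable
    also have "(\<integral>\<^sup>+u. h (t *\<^sub>R \<theta> + ((\<Sum>b\<in>B. u b *\<^sub>R b) + w)) \<partial>Pi\<^sub>M B (\<lambda>_. lborel)) = ?L"
      by (rule nn_integral_PiM_translate[where h = "\<lambda>x. h (t *\<^sub>R \<theta> + x)" and c = "\<lambda>b. w \<bullet> b"])
         (use Bfacts(1) in \<open>simp, simp, intro Bfacts(6), simp add: w_def inner_diff_left v\<theta> \<theta>1\<close>)
    finally show "(\<integral>\<^sup>+u. f (\<Sum>b\<in>insert \<theta> B. (u(\<theta> := s)) b *\<^sub>R b) \<partial>Pi\<^sub>M B (\<lambda>_. lborel)) = ?L * indicator {0..1} s" .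
  qed
  also have "\<dots> = ?L"
    by (subst nn_integral_cmult) auto
  finally have L: "(\<integral>\<^sup>+x. f x \<partial>lborel) = ?L" .

  \<comment> \<open>The same integral is now computed in standard coordinates, with the
    \<open>i\<close>-th one innermost.\<close>
  have "(\<integral>\<^sup>+x. f x \<partial>lborel) = (\<integral>\<^sup>+u. f (\<Sum>j\<in>UNIV. u j *\<^sub>R axis j 1) \<partial>Pi\<^sub>M UNIV (\<lambda>_. lborel))"
  proof (rule nn_integral_lborel_orthonormal)
    show "x = (\<Sum>j\<in>UNIV. (x \<bullet> axis j 1) *\<^sub>R axis j 1)" for x :: "real ^ 'd"
      using basis_expansion[of x] by (simp add: inner_axis scalar_mult_eq_scaleR)
  qed (auto simp: inner_axis_axis)
  also have "\<dots> = (\<integral>\<^sup>+u. f (\<Sum>j\<in>UNIV. u j *\<^sub>R axis j 1) \<partial>Pi\<^sub>M (insert i (-{i})) (\<lambda>_. lborel))"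
    by (simp add: UN)
  also have "\<dots> = (\<integral>\<^sup>+y. \<integral>\<^sup>+s. f (\<Sum>j\<in>UNIV. (y(i := s)) j *\<^sub>R axis j 1) \<partial>lborel \<partial>Pi\<^sub>M (-{i}) (\<lambda>_. lborel))"
    by (intro lborel_prod.product_nn_integral_insert) (auto intro!: measurable_compose[OF _ f])
  also have "\<dots> = (\<integral>\<^sup>+y. ennreal (1 / \<bar>\<theta> $ i\<bar>) *
      h (\<chi> j. if j = i then (t - (\<Sum>j\<in>-{i}. y j * \<theta> $ j)) / \<theta> $ i else y j) \<partial>Pi\<^sub>M (-{i}) (\<lambda>_. lborel))"
  proof (rule nn_integral_cong)
    fix y :: "'d \<Rightarrow> real"
    define c where "c = (\<Sum>j\<in>-{i}. y j * \<theta> $ j)"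
    define p :: "real ^ 'd" where "p = (\<chi> j. if j = i then (t - c) / \<theta> $ i else y j)"
    define x :: "real \<Rightarrow> real ^ 'd" where "x s = (\<Sum>j\<in>UNIV. (y(i := s)) j *\<^sub>R axis j 1)" for s
    have xj: "x s $ j = (if j = i then s else y j)" for s j
      using basis_expansion[of "\<chi> j. (y(i := s)) j"]
      by (simp add: x_def scalar_mult_eq_scaleR vec_eq_iff del: sum_component)
    have "x s \<bullet> \<theta> = (\<Sum>j\<in>insert i (-{i}). x s $ j * \<theta> $ j)" for s
      by (simp add: inner_vec_def UN)
    then have x\<theta>: "x s \<bullet> \<theta> = c + \<theta> $ i * s" for s
      by (simp add: xj c_def)
    \<comment> \<open>Projecting along the \<open>i\<close>-th axis forgets \<open>s\<close>. Only
      the slab indicator still depends on \<open>s\<close>, and it cuts out a segment of length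
      \<open>1 / \<bar>\<theta> $ i\<bar>\<close>.\<close>
    have "x s + (t - x s \<bullet> \<theta>) *\<^sub>R v = p" for s
      unfolding x\<theta> using i by (auto simp: vec_eq_iff xj p_def v_def axis_def field_simps)
    then have "(\<integral>\<^sup>+s. f (x s) \<partial>lborel) = (\<integral>\<^sup>+s. indicator {0..1} (c + \<theta> $ i * s) * h p \<partial>lborel)"
      by (simp add: f_def x\<theta> mult.commute)
    also have "\<dots> = (\<integral>\<^sup>+s. indicator {0..1} (c + \<theta> $ i * s) \<partial>lborel) * h p"
      by (rule nn_integral_multc) measurable
    also have "(\<integral>\<^sup>+s. indicator {0..1} (c + \<theta> $ i * s) \<partial>lborel) = ennreal (1 / \<bar>\<theta> $ i\<bar>)" (is "?J = _")
    proof -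
      have "ennreal \<bar>\<theta> $ i\<bar> * ?J = ennreal 1"
        using nn_integral_real_affine[of "indicator {0..1}" "\<theta> $ i" c] i by simp
      also have "\<dots> = ennreal \<bar>\<theta> $ i\<bar> * ennreal (1 / \<bar>\<theta> $ i\<bar>)"
        using i by (subst ennreal_mult[symmetric]) auto
      finally show ?thesis using i by (simp add: ennreal_mult_cancel_left)
    qed
    finally show "(\<integral>\<^sup>+s. f (\<Sum>j\<in>UNIV. (y(i := s)) j *\<^sub>R axis j 1) \<partial>lborel) = ennreal (1 / \<bar>\<theta> $ i\<bar>) *
      h (\<chi> j. if j = i then (t - (\<Sum>j\<in>-{i}. y j * \<theta> $ j)) / \<theta> $ i else y j)"
      unfolding x_def p_def c_def .
  qed
  also have "\<dots> = ?R"
    by (rule nn_integral_cmult) measurable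
  finally show ?thesis using L by simp
qed

section \<open>Iterated central differences of truncated powers\<close>

text \<open>This is the iterated central difference of \<open>f\<close> with the steps
  \<open>cs\<close>. Keeping \<open>f\<close> general allows it to be replaced by an
  antiderivative.\<close>

definition signed_sum :: "real list \<Rightarrow> (real \<Rightarrow> real) \<Rightarrow> real \<Rightarrow> real" where
  "signed_sum cs f t = (\<Sum>k\<in>sign_vectors (length cs). prod_list k * f (t + list_inner k cs))"

lemma sign_vectors_0 [simp]: "sign_vectors 0 = {[]}"
  by (auto simp: sign_vectors_def)

lemma sign_vectors_Suc: "sign_vectors (Suc n) = (#) 1 ` sign_vectors n \<union> (#) (-1) ` sign_vectors n"
  by (auto simp: sign_vectors_def length_Suc_conv image_iff)

lemma finite_sign_vectors [simp]: "finite (sign_vectors n)"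
  by (induction n) (auto simp: sign_vectors_Suc)

lemma signed_sum_Nil [simp]: "signed_sum [] f t = f t"
  by (simp add: signed_sum_def list_inner_def)

lemma signed_sum_Cons:
  "signed_sum (c # cs) f t = signed_sum cs f (t + c) - signed_sum cs f (t - c)"
proof -
  have inner: "list_inner (x # k) (c # cs) = x * c + list_inner k cs" for x k
    by (simp add: list_inner_def)
  have "(#) 1 ` sign_vectors n \<inter> (#) (-1) ` sign_vectors n = {}" for n
    by auto
  then show ?thesis
    by (simp add: signed_sum_def sign_vectors_Suc sum.union_disjoint sum.reindex inner
        sum_negf add.assoc diff_conv_add_uminus del: add_uminus_conv_diff)
qed

lemma signed_sum_divide: "signed_sum cs (\<lambda>x. f x / r) t = signed_sum cs f t / r"
  by (simp add: signed_sum_def sum_divide_distrib)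

text \<open>Linearity of the integral. The premise ranges over all \<open>s\<close> because it is
  applied at every shifted point \<open>t + list_inner k cs\<close>; the step \<open>c\<close> that
  it produces becomes a new first sign.\<close>

lemma has_integral_signed_sum:
  assumes "\<And>s. ((\<lambda>y. f (s - r * y)) has_integral g (s + c) - g (s - c)) S"
  shows "((\<lambda>y. signed_sum cs f (t - r * y)) has_integral signed_sum (c # cs) g t) S"
proof -
  have "((\<lambda>y. prod_list k * f (t - r * y + list_inner k cs)) has_integral
      prod_list k * (g (t + c + list_inner k cs) - g (t - c + list_inner k cs))) S" for k
    using has_integral_mult_right[OF assms[of "t + list_inner k cs"], of "prod_list k"]
    by (simp add: algebra_simps)
  then have "((\<lambda>y. signed_sum cs f (t - r * y)) has_integral
     (\<Sum>k\<in>sign_vectors (length cs). prod_list k * (g (t + c + list_inner k cs) - g (t - c + list_inner k cs)))) S"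
    unfolding signed_sum_def by (intro has_integral_sum) auto
  then show ?thesis
    unfolding signed_sum_Cons by (simp add: signed_sum_def right_diff_distrib sum_subtractf)
qed

text \<open>The exponent is a successor because the power with exponent 0 jumps at 0.\<close>

lemma continuous_on_trunc_power: "continuous_on UNIV (\<lambda>x. trunc_power x (Suc m))"
proof -
  have "trunc_power x (Suc m) = max 0 x ^ Suc m" for x
    by (auto simp: trunc_power_def max_def)
  then show ?thesis by (simp only:) (intro continuous_intros)
qed

text \<open>Away from 0 the function is locally a power or zero. The origin is excluded because of
  the kink there when \<open>m = 0\<close>.\<close>

lemma has_real_derivative_trunc_power:
  assumes "x \<noteq> 0"
  shows "((\<lambda>x. trunc_power x (Suc m)) has_real_derivative real (Suc m) * trunc_power x m) (at x)"
proof (cases "x > 0")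
  case True
  have "((\<lambda>x. x ^ Suc m) has_real_derivative real (Suc m) * trunc_power x m) (at x)"
    using DERIV_pow[of "Suc m" x] True by (simp add: trunc_power_def)
  then show ?thesis
    by (rule has_field_derivative_transform_within_open[where S = "{0<..}"])
       (use True in \<open>auto simp: trunc_power_def\<close>)
next
  case False
  have "((\<lambda>x. 0) has_real_derivative real (Suc m) * trunc_power x m) (at x)"
    using False by (simp add: trunc_power_def)
  then show ?thesis
    by (rule has_field_derivative_transform_within_open[where S = "{..<0}"])
       (use False assms in \<open>auto simp: trunc_power_def\<close>)
qed

lemma has_integral_trunc_power:
  assumes r: "r \<noteq> 0" and b: "b \<ge> 0"
  shows "((\<lambda>y. trunc_power (s - r * y) m) has_integral
    trunc_power (s + b * r) (Suc m) / (r * Suc m) - trunc_power (s - b * r) (Suc m) / (r * Suc m)) {-b..b}"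
proof -
  define F where "F y = - (trunc_power (s - r * y) (Suc m) / (r * Suc m))" for y
  have "((\<lambda>y. trunc_power (s - r * y) m) has_integral F b - F (-b)) {-b..b}"
  \<comment> \<open>The argument \<open>s - r * y\<close> vanishes only at \<open>s / r\<close>. As
    \<open>F\<close> is continuous, the fundamental theorem tolerates this one point without a
    derivative.\<close>
  proof (rule fundamental_theorem_of_calculus_interior_strong[where S = "{s / r}"])
    fix y assume "y \<in> {-b<..<b} - {s / r}"
    then have "s - r * y \<noteq> 0" using r by (auto simp: field_simps)
    from has_real_derivative_trunc_power[OF this]
    have "((\<lambda>y. trunc_power (s - r * y) (Suc m)) has_real_derivative
        real (Suc m) * trunc_power (s - r * y) m * (- r)) (at y)"
      by (rule DERIV_chain2[where g = "\<lambda>y. s - r * y"]) (auto intro!: derivative_eq_intros)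
    then have "(F has_real_derivative - (real (Suc m) * trunc_power (s - r * y) m * (- r) / (r * Suc m))) (at y)"
      unfolding F_def by (intro DERIV_minus DERIV_cdivide)
    then show "(F has_vector_derivative trunc_power (s - r * y) m) (at y)"
      using r by (simp add: has_real_derivative_iff_has_vector_derivative del: of_nat_Suc)
  next
    show "continuous_on {-b..b} F"
      unfolding F_def using r
      by (intro continuous_intros continuous_on_compose2[OF continuous_on_trunc_power]) auto
  qed (use b in auto)
  then show ?thesis by (simp add: F_def mult.commute)
qed

section \<open>Integrating out the coordinates one by one\<close>

text \<open>For \<open>\<tau> i \<noteq> 0\<close> this is the claimed right-hand side for the
  coordinates \<open>js\<close> and \<open>i\<close>, multiplied by
  \<open>\<bar>\<tau> i\<bar>\<close> and with the \<open>\<alpha> j\<close> of the non-zero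
  \<open>\<tau> j\<close> cancelled. The factor \<open>\<bar>\<tau> i\<bar>\<close> turns
  \<open>1 / \<tau> i\<close> into \<open>sgn (\<tau> i)\<close>. The step of \<open>i\<close> stays
  last while the list grows at its front.\<close>

definition slice_formula :: "('i \<Rightarrow> real) \<Rightarrow> ('i \<Rightarrow> real) \<Rightarrow> 'i \<Rightarrow> 'i list \<Rightarrow> real \<Rightarrow> real" where
  "slice_formula \<alpha> \<tau> i js t =
    (let zs = filter (\<lambda>j. \<tau> j = 0) js; ns = filter (\<lambda>j. \<tau> j \<noteq> 0) js
     in sgn (\<tau> i) * (2 ^ length zs * prod_list (map \<alpha> zs)) / (prod_list (map \<tau> ns) * fact (length ns)) *
        signed_sum (map (\<lambda>j. \<alpha> j * \<tau> j) (ns @ [i])) (\<lambda>x. trunc_power x (length ns)) t)"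

text \<open>The recursion of the formula along \<open>js\<close>. For
  \<open>\<tau> j \<noteq> 0\<close> the new divisor \<open>\<tau> j * Suc m\<close> extends the
  product by \<open>\<tau> j\<close> and turns \<open>fact m\<close> into
  \<open>fact (Suc m)\<close>.\<close>

lemma slice_formula_has_integral:
  assumes "\<alpha> j > 0"
  shows "((\<lambda>y. slice_formula \<alpha> \<tau> i js (t - \<tau> j * y)) has_integral slice_formula \<alpha> \<tau> i (j # js) t)
    {- \<alpha> j..\<alpha> j}"
proof (cases "\<tau> j = 0")
  case True
  have "((\<lambda>y. slice_formula \<alpha> \<tau> i js t) has_integral (2 * \<alpha> j) * slice_formula \<alpha> \<tau> i js t) {- \<alpha> j..\<alpha> j}"
    using has_integral_const_real[of "slice_formula \<alpha> \<tau> i js t" "- \<alpha> j" "\<alpha> j"] assms by simp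
  then show ?thesis using True by (simp add: slice_formula_def Let_def mult_ac)
next
  case False
  define zs where "zs = filter (\<lambda>j. \<tau> j = 0) js"
  define ns where "ns = filter (\<lambda>j. \<tau> j \<noteq> 0) js"
  define m where "m = length ns"
  define C where "C = sgn (\<tau> i) * (2 ^ length zs * prod_list (map \<alpha> zs)) / (prod_list (map \<tau> ns) * fact m)"
  define cs where "cs = map (\<lambda>j. \<alpha> j * \<tau> j) (ns @ [i])"
  have "((\<lambda>y. signed_sum cs (\<lambda>x. trunc_power x m) (t - \<tau> j * y)) has_integral
      signed_sum (\<alpha> j * \<tau> j # cs) (\<lambda>x. trunc_power x (Suc m) / (\<tau> j * Suc m)) t) {- \<alpha> j..\<alpha> j}"
    using has_integral_trunc_power[of "\<tau> j" "\<alpha> j"] False assms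
    by (intro has_integral_signed_sum) (simp del: of_nat_Suc)
  then have "((\<lambda>y. C * signed_sum cs (\<lambda>x. trunc_power x m) (t - \<tau> j * y)) has_integral
      C * (signed_sum (\<alpha> j * \<tau> j # cs) (\<lambda>x. trunc_power x (Suc m)) t / (\<tau> j * Suc m))) {- \<alpha> j..\<alpha> j}"
    unfolding signed_sum_divide by (rule has_integral_mult_right)
  moreover have "C * (signed_sum (\<alpha> j * \<tau> j # cs) (\<lambda>x. trunc_power x (Suc m)) t / (\<tau> j * Suc m))
      = slice_formula \<alpha> \<tau> i (j # js) t"
    using False by (simp add: slice_formula_def Let_def C_def cs_def m_def zs_def ns_def mult_ac del: of_nat_Suc)
  moreover have "slice_formula \<alpha> \<tau> i js x = C * signed_sum cs (\<lambda>x. trunc_power x m) x" for x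
    by (simp add: slice_formula_def Let_def C_def cs_def m_def zs_def ns_def)
  ultimately show ?thesis by simp
qed

lemma slice_formula_Nil:
  "slice_formula \<alpha> \<tau> i [] t =
    sgn (\<tau> i) * (trunc_power (t + \<alpha> i * \<tau> i) 0 - trunc_power (t - \<alpha> i * \<tau> i) 0)"
  by (simp add: slice_formula_def signed_sum_Cons)

text \<open>The alternating signs hide positivity, but each formula is an integral of the previous
  one. It is used for passing between \<open>ennreal\<close> and \<open>real\<close>.\<close>

lemma slice_formula_nonneg:
  assumes "\<alpha> i > 0" "\<forall>j\<in>set js. \<alpha> j > 0"
  shows "slice_formula \<alpha> \<tau> i js t \<ge> 0"
  using assms(2)
proof (induction js arbitrary: t)
  case Nil
  define c where "c = \<alpha> i * \<tau> i"
  have "sgn (\<tau> i) = sgn c"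
    using assms(1) by (simp add: c_def sgn_mult)
  then have "slice_formula \<alpha> \<tau> i [] t = sgn c * (trunc_power (t + c) 0 - trunc_power (t - c) 0)"
    by (simp add: slice_formula_Nil c_def)
  \<comment> \<open>The step function is monotone, so the difference has the sign of
    \<open>c\<close> or vanishes.\<close>
  also have "\<dots> \<ge> 0"
    by (auto simp: trunc_power_def sgn_if)
  finally show ?case .
next
  case (Cons j js)
  show ?case
    by (rule has_integral_nonneg[OF slice_formula_has_integral]) (use Cons in auto)
qed

text \<open>The side condition is needed because for \<^term>\<open>\<tau> i < 0\<close> the formula with empty
  \<^term>\<open>js\<close> has the wrong value at the two jumps. One integration against a non-zero
  coefficient makes these two points irrelevant.\<close>

lemma nn_integral_box_slice:
  assumes \<alpha>: "\<alpha> i > 0" "\<forall>j\<in>set js. \<alpha> j > 0" and \<tau>: "\<tau> i \<noteq> 0"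
    and "distinct js" and "(\<exists>j\<in>set js. \<tau> j \<noteq> 0) \<or> \<tau> i > 0 \<or> \<bar>t\<bar> \<noteq> \<bar>\<alpha> i * \<tau> i\<bar>"
  shows "(\<integral>\<^sup>+y. (\<Prod>j\<in>set js. indicator {- \<alpha> j<..\<alpha> j} (y j)) *
      indicator {- \<alpha> i<..\<alpha> i} ((t - (\<Sum>j\<in>set js. y j * \<tau> j)) / \<tau> i) \<partial>Pi\<^sub>M (set js) (\<lambda>_. lborel))
    = ennreal (slice_formula \<alpha> \<tau> i js t)"
  using assms(2,4,5)
proof (induction js arbitrary: t)
  case Nil
  have "indicator {- \<alpha> i<..\<alpha> i} (t / \<tau> i) = ennreal (slice_formula \<alpha> \<tau> i [] t)"
  proof (cases "\<tau> i > 0")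
    case True
    then have "- \<alpha> i < t / \<tau> i \<longleftrightarrow> - (\<alpha> i * \<tau> i) < t" "t / \<tau> i \<le> \<alpha> i \<longleftrightarrow> t \<le> \<alpha> i * \<tau> i"
      "0 < \<alpha> i * \<tau> i"
      using \<alpha>(1) by (simp_all add: field_simps)
    then show ?thesis
      using True by (simp add: slice_formula_Nil trunc_power_def indicator_def)
  next
    case False
    \<comment> \<open>Dividing by a negative number flips the half-open interval to one closed on
      the left, whereas the formula gives one closed on the right. They differ only at the excluded
      points \<open>\<bar>t\<bar> = \<bar>\<alpha> i * \<tau> i\<bar>\<close>.\<close>
    then have neg: "\<tau> i < 0" using \<tau> by simp
    then have "- \<alpha> i < t / \<tau> i \<longleftrightarrow> t < - (\<alpha> i * \<tau> i)" "t / \<tau> i \<le> \<alpha> i \<longleftrightarrow> \<alpha> i * \<tau> i \<le> t"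
      by (simp_all add: field_simps)
    moreover have "\<alpha> i * \<tau> i < 0" using \<alpha>(1) neg by (rule mult_pos_neg)
    moreover have "\<bar>t\<bar> \<noteq> \<bar>\<alpha> i * \<tau> i\<bar>" using Nil.prems(3) False by auto
    ultimately show ?thesis
      using neg by (auto simp: slice_formula_Nil trunc_power_def indicator_def)
  qed
  then show ?case by (simp add: PiM_empty)
next
  case (Cons j js)
  define I where "I t = (\<integral>\<^sup>+y. (\<Prod>j\<in>set js. indicator {- \<alpha> j<..\<alpha> j} (y j)) *
      indicator {- \<alpha> i<..\<alpha> i} ((t - (\<Sum>j\<in>set js. y j * \<tau> j)) / \<tau> i) \<partial>Pi\<^sub>M (set js) (\<lambda>_. lborel))" for t
  have j: "j \<notin> set js" using Cons.prems by simp
  \<comment> \<open>A null set: the endpoint at which the half-open and closed intervals differ and,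
    if \<open>\<tau> j \<noteq> 0\<close>, the two values of \<open>s\<close> that put
    \<open>t - \<tau> j * s\<close> on a jump. Off it the induction hypothesis applies; for
    \<open>\<tau> j = 0\<close> its side condition is inherited.\<close>
  define N where "N = (if \<tau> j = 0 then {- \<alpha> j}
    else {- \<alpha> j, (t - \<alpha> i * \<tau> i) / \<tau> j, (t + \<alpha> i * \<tau> i) / \<tau> j})"
  have "AE s in lborel. s \<notin> N"
    by (intro AE_not_in countable_imp_null_set_lborel) (simp add: N_def)
  then have AE: "AE s in lborel. indicator {- \<alpha> j<..\<alpha> j} s * I (t - \<tau> j * s)
      = ennreal (slice_formula \<alpha> \<tau> i js (t - \<tau> j * s)) * indicator {- \<alpha> j..\<alpha> j} s"
  proof eventually_elim
    case (elim s)
    have "I (t - \<tau> j * s) = ennreal (slice_formula \<alpha> \<tau> i js (t - \<tau> j * s))"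
      unfolding I_def
    proof (rule Cons.IH)
      show "(\<exists>j\<in>set js. \<tau> j \<noteq> 0) \<or> 0 < \<tau> i \<or> \<bar>t - \<tau> j * s\<bar> \<noteq> \<bar>\<alpha> i * \<tau> i\<bar>"
      proof (cases "\<tau> j = 0")
        case True
        then show ?thesis using Cons.prems(3) by auto
      next
        case False
        then have "t - \<tau> j * s \<noteq> \<alpha> i * \<tau> i" "t - \<tau> j * s \<noteq> - (\<alpha> i * \<tau> i)"
          using elim by (auto simp: N_def field_simps)
        then show ?thesis by (auto simp: abs_eq_iff)
      qed
    qed (use Cons.prems in auto)
    moreover have "indicator {- \<alpha> j<..\<alpha> j} s = (indicator {- \<alpha> j..\<alpha> j} s :: ennreal)"
      using elim by (auto simp: N_def indicator_def split: if_splits)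
    ultimately show ?case by (simp add: mult.commute)
  qed
  have "(\<integral>\<^sup>+y. (\<Prod>j\<in>set (j # js). indicator {- \<alpha> j<..\<alpha> j} (y j)) *
      indicator {- \<alpha> i<..\<alpha> i} ((t - (\<Sum>j\<in>set (j # js). y j * \<tau> j)) / \<tau> i) \<partial>Pi\<^sub>M (set (j # js)) (\<lambda>_. lborel))
    = (\<integral>\<^sup>+s. \<integral>\<^sup>+y. (\<Prod>k\<in>insert j (set js). indicator {- \<alpha> k<..\<alpha> k} ((y(j := s)) k)) *
      indicator {- \<alpha> i<..\<alpha> i} ((t - (\<Sum>k\<in>insert j (set js). (y(j := s)) k * \<tau> k)) / \<tau> i)
        \<partial>Pi\<^sub>M (set js) (\<lambda>_. lborel) \<partial>lborel)"
    unfolding list.set by (rule lborel_prod.product_nn_integral_insert_rev) (use j in \<open>simp, simp, measurable\<close>)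
  also have "\<dots> = (\<integral>\<^sup>+(s::real). indicator {- \<alpha> j<..\<alpha> j} s * I (t - \<tau> j * s) \<partial>lborel)"
  proof (rule nn_integral_cong)
    fix s :: real
    have P: "(\<Prod>k\<in>insert j (set js). indicator {- \<alpha> k<..\<alpha> k} ((y(j := s)) k))
      = indicator {- \<alpha> j<..\<alpha> j} s * (\<Prod>k\<in>set js. indicator {- \<alpha> k<..\<alpha> k} (y k) :: ennreal)" for y
      using j by (auto intro!: prod.cong arg_cong2[where f = "(*)"])
    have S: "t - (\<Sum>k\<in>insert j (set js). (y(j := s)) k * \<tau> k) = t - \<tau> j * s - (\<Sum>k\<in>set js. y k * \<tau> k)" for y
    proof -
      have "(\<Sum>k\<in>set js. (y(j := s)) k * \<tau> k) = (\<Sum>k\<in>set js. y k * \<tau> k)"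
        using j by (intro sum.cong) auto
      then show ?thesis using j by simp
    qed
    show "(\<integral>\<^sup>+y. (\<Prod>k\<in>insert j (set js). indicator {- \<alpha> k<..\<alpha> k} ((y(j := s)) k)) *
      indicator {- \<alpha> i<..\<alpha> i} ((t - (\<Sum>k\<in>insert j (set js). (y(j := s)) k * \<tau> k)) / \<tau> i)
        \<partial>Pi\<^sub>M (set js) (\<lambda>_. lborel)) = indicator {- \<alpha> j<..\<alpha> j} s * I (t - \<tau> j * s)"
      unfolding P S I_def mult.assoc by (rule nn_integral_cmult) measurable
  qed
  also have "\<dots> = (\<integral>\<^sup>+s. ennreal (slice_formula \<alpha> \<tau> i js (t - \<tau> j * s)) * indicator {- \<alpha> j..\<alpha> j} s \<partial>lborel)"
    by (rule nn_integral_cong_AE[OF AE])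
  also have "\<dots> = ennreal (slice_formula \<alpha> \<tau> i (j # js) t)"
    using Cons.prems \<alpha>(1)
    by (intro nn_integral_has_integral_lebesgue' slice_formula_has_integral slice_formula_nonneg) auto
  finally show ?case .
qed

section \<open>The Radon transform of the cube\<close>

text \<open>Completion leaves integrals of Borel functions unchanged, and the parametrisation stays
  in the hyperplane, so its indicator is 1. The basis is the one chosen in
  \<open>surface_measure\<close>; only its orthonormality is passed on.\<close>

lemma radon_indicator:
  fixes \<theta> :: "'a::euclidean_space"
  assumes \<theta>: "norm \<theta> = 1" and Q[measurable]: "Q \<in> sets borel"
  obtains B where "is_orthonormal_basis_of B (hyperplane \<theta> 0)"
    and "radon \<theta> (indicat_real Q) t =
      enn2real (\<integral>\<^sup>+u. indicator Q (t *\<^sub>R \<theta> + (\<Sum>b\<in>B. u b *\<^sub>R b)) \<partial>Pi\<^sub>M B (\<lambda>_. lborel))"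
proof
  define B where "B = (SOME B. is_orthonormal_basis_of B (hyperplane \<theta> 0))"
  show B: "is_orthonormal_basis_of B (hyperplane \<theta> 0)"
    unfolding B_def using hyperplane_orthonormal_basis_exists by (rule someI_ex)
  note Bfacts = orthonormal_basis_insert_normal[OF B \<theta>]
  define \<phi> where "\<phi> u = t *\<^sub>R \<theta> + (\<Sum>b\<in>B. u b *\<^sub>R b)" for u :: "'a \<Rightarrow> real"
  define P where "P = Pi\<^sub>M B (\<lambda>_. lborel :: real measure)"
  have \<phi>[measurable]: "\<phi> \<in> borel_measurable P"
    unfolding \<phi>_def P_def by measurable
  have "\<phi> u \<bullet> \<theta> = t" for u
    using Bfacts(2,4) \<theta>
    by (auto simp: \<phi>_def inner_add_left inner_sum_left norm_eq_1 intro!: sum.neutral)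
  then have H: "\<phi> u \<in> hyperplane \<theta> t" for u
    by (simp add: hyperplane_def)
  have [measurable]: "hyperplane \<theta> t \<in> sets borel"
    unfolding hyperplane_def by measurable
  have "radon \<theta> (indicat_real Q) t
      = (\<integral>x. indicator (hyperplane \<theta> t) x *\<^sub>R indicat_real Q x \<partial>completion (distr P borel \<phi>))"
    by (simp add: radon_def surface_measure_def set_lebesgue_integral_def Let_def B_def P_def \<phi>_def[abs_def])
  also have "\<dots> = (\<integral>x. indicator (hyperplane \<theta> t) x *\<^sub>R indicat_real Q x \<partial>distr P borel \<phi>)"
    by (rule integral_completion) measurable
  also have "\<dots> = (\<integral>u. indicat_real Q (\<phi> u) \<partial>P)"
    by (subst integral_distr) (auto simp: H)
  also have "\<dots> = enn2real (\<integral>\<^sup>+u. indicator Q (\<phi> u) \<partial>P)"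
    by (subst integral_eq_nn_integral) (auto simp: ennreal_indicator)
  finally show "radon \<theta> (indicat_real Q) t =
      enn2real (\<integral>\<^sup>+u. indicator Q (t *\<^sub>R \<theta> + (\<Sum>b\<in>B. u b *\<^sub>R b)) \<partial>Pi\<^sub>M B (\<lambda>_. lborel))"
    by (simp add: \<phi>_def P_def)
qed

lemma radon_half_open_cube:
  fixes \<theta> a :: "real ^ 'd"
  assumes \<theta>: "norm \<theta> = 1" "\<theta> $ i \<noteq> 0" and a: "\<forall>i. a $ i > 0"
    and js: "distinct js" "set js = - {i}"
    and t: "(\<exists>j\<in>-{i}. \<theta> $ j \<noteq> 0) \<or> \<theta> $ i > 0 \<or> \<bar>t\<bar> \<noteq> \<bar>a $ i * \<theta> $ i\<bar>"
  shows "radon \<theta> (indicat_real (half_open_cube a)) t = slice_formula (($) a) (($) \<theta>) i js t / \<bar>\<theta> $ i\<bar>"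
proof -
  have [measurable]: "half_open_cube a \<in> sets borel"
    unfolding half_open_cube_def by measurable
  from radon_indicator[OF \<theta>(1) this, of t] obtain B
    where B: "is_orthonormal_basis_of B (hyperplane \<theta> 0)"
      and R: "radon \<theta> (indicat_real (half_open_cube a)) t = enn2real (\<integral>\<^sup>+u.
        indicator (half_open_cube a) (t *\<^sub>R \<theta> + (\<Sum>b\<in>B. u b *\<^sub>R b)) \<partial>Pi\<^sub>M B (\<lambda>_. lborel))"
    by blast
  \<comment> \<open>Along the graph the cube indicator factors into intervals, the
    \<open>i\<close>-th evaluated at the coordinate solved from the hyperplane equation. This is the
    integrand of \<open>nn_integral_box_slice\<close>.\<close>
  have "indicator (half_open_cube a) (\<chi> j. if j = i then (t - (\<Sum>j\<in>-{i}. y j * \<theta> $ j)) / \<theta> $ i else y j)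
      = (\<Prod>j\<in>-{i}. indicator {- a $ j<..a $ j} (y j)) *
        (indicator {- a $ i<..a $ i} ((t - (\<Sum>j\<in>-{i}. y j * \<theta> $ j)) / \<theta> $ i) :: ennreal)"
    (is "indicator _ ?x = ?P * ?g") for y
  proof -
    have UN: "insert i (-{i}) = UNIV" by auto
    have ind: "(indicator (half_open_cube a) x :: ennreal) = (\<Prod>j\<in>UNIV. indicator {- a $ j<..a $ j} (x $ j))" for x
    proof (cases "x \<in> half_open_cube a")
      case False
      then obtain j where "x $ j \<notin> {- a $ j<..a $ j}" by (auto simp: half_open_cube_def)
      then have "(\<Prod>j\<in>UNIV. indicator {- a $ j<..a $ j} (x $ j)) = (0 :: ennreal)"
        by (intro prod_zero) (auto intro!: exI[of _ j])
      then show ?thesis using False by simp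
    qed (auto simp: half_open_cube_def)
    then have "indicator (half_open_cube a) ?x = (\<Prod>j\<in>insert i (-{i}). indicator {- a $ j<..a $ j} (?x $ j) :: ennreal)"
      by (simp add: UN)
    then show ?thesis by (simp add: mult.commute)
  qed
  then have "(\<integral>\<^sup>+u. indicator (half_open_cube a) (t *\<^sub>R \<theta> + (\<Sum>b\<in>B. u b *\<^sub>R b)) \<partial>Pi\<^sub>M B (\<lambda>_. lborel))
    = ennreal (1 / \<bar>\<theta> $ i\<bar>) * ennreal (slice_formula (($) a) (($) \<theta>) i js t)"
    using nn_integral_hyperplane_graph[OF B \<theta>, of "indicator (half_open_cube a)" t]
      nn_integral_box_slice[of "($) a" i js "($) \<theta>" t] a js t \<theta>(2)
    by simp
  also have "\<dots> = ennreal (slice_formula (($) a) (($) \<theta>) i js t / \<bar>\<theta> $ i\<bar>)"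
    by (subst ennreal_mult''[symmetric]) (use a in \<open>auto intro!: slice_formula_nonneg\<close>)
  finally show ?thesis
    unfolding R using slice_formula_nonneg[of "($) a" i js "($) \<theta>" t] a by simp
qed

text \<open>The last hypothesis excludes the only false values. For
  \<open>\<theta> = - axis i 1\<close> the slice is empty at \<open>t = a $ i\<close> and a facet at
  \<open>t = - a $ i\<close>, while the formula with \<open>trunc_power 0 0 = 0\<close> gives the
  facet area and 0 respectively.\<close>

theorem theorem1:
  fixes \<theta> a :: "real ^ 'd::{finite,linorder}" and t :: real and l :: nat
  assumes "\<theta> \<in> sphere 0 1"
    and "\<forall>i. a $ i > 0"
    and "l = num_nonzero \<theta>"
    and "\<forall>i. \<theta> = - axis i 1 \<longrightarrow> \<bar>t\<bar> \<noteq> a $ i"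
  shows "radon \<theta> (indicat_real (half_open_cube a)) t =
    2 ^ (CARD('d) - l) * (\<Prod>i\<in>UNIV. a $ i) / (prod_list (nonzero_entries (a * \<theta>)) * fact (l - 1)) *
    (\<Sum>k\<in>sign_vectors l. prod_list k *
       trunc_power (t + list_inner k (nonzero_entries (a * \<theta>))) (l - 1))"
proof -
  have \<theta>1: "norm \<theta> = 1" using assms(1) by simp
  define Z where "Z = {i. \<theta> $ i = 0}"
  define N where "N = {i. \<theta> $ i \<noteq> 0}"
  define zs where "zs = sorted_list_of_set Z"
  define L where "L = sorted_list_of_set N"
  have "\<theta> \<noteq> 0" using \<theta>1 by auto
  then have "N \<noteq> {}" by (auto simp: N_def vec_eq_iff)
  then have "L \<noteq> []" by (simp add: L_def)
  \<comment> \<open>The last non-zero index is singled out so that \<open>ns @ [i]\<close> has the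
    increasing order of \<open>nonzero_entries\<close>.\<close>
  then obtain ns i where ns: "L = ns @ [i]" by (metis rev_exhaust)
  have setL: "set L = N" and distL: "distinct L" by (simp_all add: L_def)
  have setz: "set zs = Z" and distz: "distinct zs" by (simp_all add: zs_def)
  have setns: "set ns = N - {i}" and i: "\<theta> $ i \<noteq> 0" and ins: "i \<notin> set ns" and distns: "distinct ns"
    using setL distL by (auto simp: ns N_def)
  have js: "distinct (zs @ ns)" "set (zs @ ns) = - {i}"
    using setns distns setz distz i by (auto simp: Z_def N_def)
  have l: "l = Suc (length ns)"
    using assms(3) distinct_card[OF distL] setL by (simp add: num_nonzero_def ns N_def)
  have "card Z = CARD('d) - l"
  proof -
    have "Z = UNIV - N" by (auto simp: Z_def N_def)
    then show ?thesis using assms(3) by (simp add: card_Diff_subset num_nonzero_def N_def)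
  qed
  then have lz: "length zs = CARD('d) - l"
    using distinct_card[OF distz] setz by simp
  \<comment> \<open>If this failed, \<open>\<theta>\<close> would be a unit vector on the
    \<open>i\<close>-th axis with a negative entry, and \<open>t\<close> would be one of the
    excluded values.\<close>
  have t: "(\<exists>j\<in>-{i}. \<theta> $ j \<noteq> 0) \<or> \<theta> $ i > 0 \<or> \<bar>t\<bar> \<noteq> \<bar>a $ i * \<theta> $ i\<bar>"
  proof (rule ccontr)
    assume *: "\<not> ?thesis"
    then have ax: "\<theta> = axis i (\<theta> $ i)" by (auto simp: vec_eq_iff axis_def)
    have "\<theta> \<bullet> \<theta> = \<theta> $ i * \<theta> $ i" by (subst ax) (simp add: inner_axis')
    then have "\<theta> $ i * \<theta> $ i = 1" using \<theta>1 by (simp add: norm_eq_1)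
    then have "\<theta> $ i = -1" using * by (auto simp: square_eq_1_iff)
    then have "\<theta> = - axis i 1" using ax by (auto simp: vec_eq_iff axis_def)
    then show False using assms(2,4) * \<open>\<theta> $ i = -1\<close> by (auto dest: spec[of _ i] simp: abs_of_pos)
  qed
  have nz: "nonzero_entries (a * \<theta>) = map (\<lambda>j. a $ j * \<theta> $ j) (ns @ [i])"
  proof -
    have "a $ j \<noteq> 0" for j using assms(2) by (metis less_irrefl)
    then have "{j. (a * \<theta>) $ j \<noteq> 0} = N" by (auto simp: N_def)
    then show ?thesis by (simp add: nonzero_entries_def flip: ns L_def)
  qed
  have f: "filter (\<lambda>j. \<theta> $ j = 0) (zs @ ns) = zs" "filter (\<lambda>j. \<theta> $ j \<noteq> 0) (zs @ ns) = ns"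
    using setz setns by (auto simp: Z_def N_def filter_empty_conv intro!: filter_True)
  have pa: "(\<Prod>i\<in>UNIV. a $ i) = prod_list (map (($) a) zs) * (prod_list (map (($) a) ns) * a $ i)"
  proof -
    have "(\<Prod>i\<in>UNIV. a $ i) = prod (($) a) (set (zs @ ns @ [i]))"
      using js(2) by (intro prod.cong) auto
    also have "\<dots> = prod_list (map (($) a) (zs @ ns @ [i]))"
      by (rule prod.distinct_set_conv_list) (use js ins in auto)
    finally show ?thesis by simp
  qed
  have pn: "prod_list (map (\<lambda>j. a $ j * \<theta> $ j) xs) = prod_list (map (($) a) xs) * prod_list (map (($) \<theta>) xs)" for xs
    by (induction xs) auto
  have an: "prod_list (map (($) a) ns) \<noteq> 0" "a $ i \<noteq> 0"
    using assms(2) by (auto simp: prod_list_zero_iff) (metis less_irrefl)+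
  define X where "X = signed_sum (nonzero_entries (a * \<theta>)) (\<lambda>x. trunc_power x (length ns)) t"
  have "radon \<theta> (indicat_real (half_open_cube a)) t = slice_formula (($) a) (($) \<theta>) i (zs @ ns) t / \<bar>\<theta> $ i\<bar>"
    by (rule radon_half_open_cube[OF \<theta>1 i assms(2) js t])
  also have "\<dots> = sgn (\<theta> $ i) / \<bar>\<theta> $ i\<bar> * (2 ^ (CARD('d) - l) * prod_list (map (($) a) zs)) /
      (prod_list (map (($) \<theta>) ns) * fact (length ns)) * X"
    unfolding slice_formula_def f Let_def X_def nz lz by simp
  \<comment> \<open>The sign and the absolute value merge into the divisor missing from the product
    over \<open>ns\<close>.\<close>
  also have "sgn (\<theta> $ i) / \<bar>\<theta> $ i\<bar> = 1 / \<theta> $ i"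
    by (simp add: sgn_if)
  also have "1 / \<theta> $ i * (2 ^ (CARD('d) - l) * prod_list (map (($) a) zs)) / (prod_list (map (($) \<theta>) ns) * fact (length ns)) * X
     = 2 ^ (CARD('d) - l) * (\<Prod>i\<in>UNIV. a $ i) / (prod_list (nonzero_entries (a * \<theta>)) * fact (l - 1)) * X"
    unfolding pa nz pn using an by (simp add: pn l field_simps)
  also have "X = (\<Sum>k\<in>sign_vectors l. prod_list k *
       trunc_power (t + list_inner k (nonzero_entries (a * \<theta>))) (l - 1))"
    by (simp add: X_def signed_sum_def nz l)
  finally show ?thesis .
qed

end
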